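(* In the online mixed packing and covering setting of the context, if the scaling parameter satisfies $4\sigma\, OPT\ge\Gamma\ge 2\sigma\, OPT$, then Algorithm MPC-Approx run with $\Gamma$ does not fail, and the solution $\mathbf{x}$ it maintains satisfies $\max_k(\mathbf{P}\mathbf{x})_k\le 8\sigma\ln(em)\cdot OPT$ (i.e., it is $8\sigma\ln(em)$-competitive).
   Context: Online mixed packing and covering (OMPC): there are $n$ nonnegative variables $\mathbf{x}=(x_1,\dots,x_n)$. A nonnegative $m\times n$ matrix $\mathbf{P}=(p_{kj})$ (packing constraints) is known in advance; the rows of a nonnegative $m_c\times n$ matrix $\mathbf{C}=(c_{ij})$ (covering constraints $(\mathbf{C}\mathbf{x})_i\ge 1$) arrive one at a time. The goal is to solve $\min \lambda$ s.t. $\mathbf{C}\mathbf{x}\ge\mathbf{1}$, $\mathbf{P}\mathbf{x}\le\lambda\mathbf{1}$, $\mathbf{x}\ge 0$ online: variables may only be increased, and each newly arrived covering constraint must be satisfied. $OPT$ is the optimal value of this LP for the full $\mathbf{P},\mathbf{C}$. Parameters: $d$ is the maximum number of variables in any packing or covering constraint; $\rho=\max_{k,j}p_{kj}/\min_{k,j:p_{kj}>0}p_{kj}$; $\kappa=\max_{i,j}c_{ij}/\min_{i,j:c_{ij}>0}c_{ij}$; $\kappa_1=\max_j c_{1j}$ for the first covering constraint to arrive; $d_1$ is the maximum number of variables in any packing constraint or in the first covering constraint; $\mu=1+\frac{1}{3\ln(em)}$; $\sigma=e^2\ln(\mu d^2\rho\kappa)$. Algorithm MPC-Approx with scaling parameter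 $\Gamma>0$: let $\tilde{\mathbf{P}}=\mathbf{P}/\Gamma$, $\tilde\lambda(\mathbf{x})=\max_k(\tilde{\mathbf{P}}\mathbf{x})_k$, $\Phi(\mathbf{x})=\ln\sum_{k=1}^m\exp((\tilde{\mathbf{P}}\mathbf{x})_k)$, $r_j(\mathbf{x})=\partial\Phi/\partial x_j=\frac{\sum_k\tilde p_{kj}\exp((\tilde{\mathbf{P}}\mathbf{x})_k)}{\sum_k\exp((\tilde{\mathbf{P}}\mathbf{x})_k)}$. When the first covering constraint arrives, set $x_j=1/(d_1^2\rho\kappa_1)$ for all $j$. When the $i$-th covering constraint arrives (with a new variable $y_i=0$), repeat the following phase while $(\mathbf{C}\mathbf{x})_i<1$: let $\mathbf{x}^l$ be the current $\mathbf{x}$; $\epsilon_i=(\mu-1)\min_{j:c_{ij}>0}r_j(\mathbf{x}^l)/c_{ij}$; for every $j$, $x_j\leftarrow x_j(1+\epsilon_i c_{ij}/r_j(\mathbf{x}^l))$; $y_i\leftarrow y_i+e\epsilon_i$; if $\tilde\lambda(\mathbf{x})\ge 3\ln(em)$, stop and return FAIL. The algorithm does not fail if it never returns FAIL.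
   Formalization: Every variable with a positive coefficient in a covering constraint is assumed to occur in some packing constraint (so r_j > 0 where the algorithm divides by it); otherwise the bound fails, e.g. P = [0,1] with covering rows (1,0), (0,K), K large. *)

theory Defs imports "HOL-Analysis.Analysis" begin

text \<open>
  The variables are indexed by the type \<^typ>\<open>'n\<close> and the packing constraints by \<^typ>\<open>'m\<close>.
  The covering constraints form a list of rows in order of arrival.
\<close>

definition mpc_feasible :: "real^'n^'m \<Rightarrow> (real^'n) list \<Rightarrow> real^'n \<Rightarrow> real \<Rightarrow> bool" where
  "mpc_feasible P C x lam \<longleftrightarrow>
     (\<forall>j. 0 \<le> x $ j) \<and> (\<forall>c\<in>set C. 1 \<le> c \<bullet> x) \<and> (\<forall>k. (P *v x) $ k \<le> lam)"

text \<open>Meaningful only if the linear program is feasible.\<close>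

definition mpc_opt :: "real^'n^'m \<Rightarrow> (real^'n) list \<Rightarrow> real" where
  "mpc_opt P C = Inf {lam. \<exists>x. mpc_feasible P C x lam}"

definition num_vars :: "real^'n \<Rightarrow> nat" where
  "num_vars a = card {j. a $ j \<noteq> 0}"

text \<open>
  The parameter \<open>d\<close> is \<open>max_vars P C\<close>, and \<open>d\<^sub>1\<close> is \<open>max_vars P [hd C]\<close>.
\<close>

definition max_vars :: "real^'n^'m \<Rightarrow> (real^'n) list \<Rightarrow> nat" where
  "max_vars P C = Max (num_vars ` (range (\<lambda>k. P $ k) \<union> set C))"

definition mpc_rho :: "real^'n^'m \<Rightarrow> real" where
  "mpc_rho P = Max {P $ k $ j |k j. True} / Min {P $ k $ j |k j. 0 < P $ k $ j}"

definition mpc_kappa :: "(real^'n) list \<Rightarrow> real" where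
  "mpc_kappa C = Max {c $ j |c j. c \<in> set C} / Min {c $ j |c j. c \<in> set C \<and> 0 < c $ j}"

definition mpc_kappa1 :: "(real^'n) list \<Rightarrow> real" where
  "mpc_kappa1 C = (MAX j. hd C $ j)"

definition mpc_mu :: "nat \<Rightarrow> real" where
  "mpc_mu m = 1 + 1 / (3 * ln (exp 1 * real m))"

definition mpc_sigma :: "real^'n^'m \<Rightarrow> (real^'n) list \<Rightarrow> real" where
  "mpc_sigma P C =
     (exp 1)\<^sup>2 * ln (mpc_mu CARD('m) * (real (max_vars P C))\<^sup>2 * mpc_rho P * mpc_kappa C)"

definition scaled_load :: "real^'n^'m \<Rightarrow> real \<Rightarrow> real^'n \<Rightarrow> real" where
  "scaled_load P \<Gamma> x = (MAX k. ((P /\<^sub>R \<Gamma>) *v x) $ k)"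

definition mpc_potential :: "real^'n^'m \<Rightarrow> real \<Rightarrow> real^'n \<Rightarrow> real" where
  "mpc_potential P \<Gamma> x = ln (\<Sum>k\<in>UNIV. exp (((P /\<^sub>R \<Gamma>) *v x) $ k))"

definition mpc_rate :: "real^'n^'m \<Rightarrow> real \<Rightarrow> real^'n \<Rightarrow> 'n \<Rightarrow> real" where
  "mpc_rate P \<Gamma> x j =
     (\<Sum>k\<in>UNIV. (P /\<^sub>R \<Gamma>) $ k $ j * exp (((P /\<^sub>R \<Gamma>) *v x) $ k)) /
     (\<Sum>k\<in>UNIV. exp (((P /\<^sub>R \<Gamma>) *v x) $ k))"

lemma mpc_rate_partial_derivative:
  fixes P :: "real^'n^'m"
  shows "((\<lambda>t. mpc_potential P \<Gamma> (x + t *\<^sub>R axis j 1)) has_real_derivative mpc_rate P \<Gamma> x j) (at 0)"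
proof -
  let ?Q = "P /\<^sub>R \<Gamma>"
  have pos: "0 < (\<Sum>k\<in>UNIV. exp ((?Q *v x) $ k))"
    by (intro sum_pos) auto
  have *: "(?Q *v (x + t *\<^sub>R axis j 1)) $ k = (?Q *v x) $ k + t * ?Q $ k $ j" for t k
    by (simp add: matrix_vector_right_distrib matrix_vector_mult_scaleR matrix_vector_mult_basis column_def)
  show ?thesis
    unfolding mpc_potential_def mpc_rate_def *
    using pos by (auto intro!: derivative_eq_intros simp: mult.commute)
qed

definition mpc_init :: "real^'n^'m \<Rightarrow> (real^'n) list \<Rightarrow> real^'n" where
  "mpc_init P C = (\<chi> j. 1 / ((real (max_vars P [hd C]))\<^sup>2 * mpc_rho P * mpc_kappa1 C))"

definition phase_eps :: "real^'n^'m \<Rightarrow> real \<Rightarrow> real^'n \<Rightarrow> real^'n \<Rightarrow> real" where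
  "phase_eps P \<Gamma> c x =
     (mpc_mu CARD('m) - 1) * Min {mpc_rate P \<Gamma> x j / c $ j |j. 0 < c $ j}"

definition phase_update :: "real^'n^'m \<Rightarrow> real \<Rightarrow> real^'n \<Rightarrow> real^'n \<Rightarrow> real^'n" where
  "phase_update P \<Gamma> c x =
     (\<chi> j. x $ j * (1 + phase_eps P \<Gamma> c x * c $ j / mpc_rate P \<Gamma> x j))"

text \<open>
  In \<open>Run i x y\<close> the constraints \<open>C ! 0, \<dots>, C ! (i - 1)\<close> have been processed and \<open>C ! i\<close>
  (if \<open>i < length C\<close>) is being processed, so \<open>Run (length C) x y\<close> is a completed run.
  The entries of \<open>y\<close> at constraints that have not arrived yet are 0.
\<close>

datatype ('n::finite) mpc_config = Run nat "real^'n" "nat \<Rightarrow> real" | FAIL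

inductive mpc_step ::
  "real^'n^'m \<Rightarrow> (real^'n) list \<Rightarrow> real \<Rightarrow> 'n mpc_config \<Rightarrow> 'n mpc_config \<Rightarrow> bool"
  for P C \<Gamma> where
  satisfied: "i < length C \<Longrightarrow> 1 \<le> C ! i \<bullet> x \<Longrightarrow>
    mpc_step P C \<Gamma> (Run i x y) (Run (Suc i) x y)"
| phase: "i < length C \<Longrightarrow> C ! i \<bullet> x < 1 \<Longrightarrow>
    x' = phase_update P \<Gamma> (C ! i) x \<Longrightarrow>
    y' = y(i := y i + exp 1 * phase_eps P \<Gamma> (C ! i) x) \<Longrightarrow>
    scaled_load P \<Gamma> x' < 3 * ln (exp 1 * real CARD('m)) \<Longrightarrow>
    mpc_step P C \<Gamma> (Run i x y) (Run i x' y')"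
| fail: "i < length C \<Longrightarrow> C ! i \<bullet> x < 1 \<Longrightarrow>
    x' = phase_update P \<Gamma> (C ! i) x \<Longrightarrow>
    scaled_load P \<Gamma> x' \<ge> 3 * ln (exp 1 * real CARD('m)) \<Longrightarrow>
    mpc_step P C \<Gamma> (Run i x y) FAIL"

definition mpc_reachable ::
  "real^'n^'m \<Rightarrow> (real^'n) list \<Rightarrow> real \<Rightarrow> 'n mpc_config \<Rightarrow> bool" where
  "mpc_reachable P C \<Gamma> s \<longleftrightarrow> (mpc_step P C \<Gamma>)\<^sup>*\<^sup>* (Run 0 (mpc_init P C) (\<lambda>i. 0)) s"

end

theory Submission imports Defs begin

text \<open>
  Every phase raises \<open>\<Phi>\<close> by at most \<open>e \<epsilon>\<close>, so \<open>D = \<Phi>(x) - \<Phi>(x\<^sub>0)\<close> is at most \<open>e E\<close>, where \<open>E\<close> is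
  the sum of all \<open>\<epsilon>\<close>. A variable grows by a factor of at most \<open>\<mu> d\<^sup>2 \<rho> \<kappa>\<close> during the run,
  which bounds the sum of \<open>\<epsilon> c\<^sub>i\<^sub>j / r\<^sub>j\<close> over all phases by \<open>\<sigma> / e\<close>. The rate \<open>r\<^sub>j\<close> is a combination of scaled packing
  entries with softmax weights, and the running maxima of these weights sum to at most \<open>1 + D\<close>.
  Linear programming duality with these maxima as packing multipliers yields
  \<open>D \<le> \<sigma> (OPT / \<Gamma>) (1 + D) \<le> (1 + D) / 2\<close>, that is, \<open>D \<le> 1\<close>. The initial point has packing load
  at most \<open>OPT\<close>, so \<open>\<Phi>\<close> never exceeds \<open>2 ln(em)\<close>, which is below the failure threshold. As some
  variable grows by the factor \<open>\<mu>\<close> in each phase, there are finitely many phases.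
\<close>

section \<open>Elementary bounds on the exponential and the logarithm\<close>

lemma exp_le_chord:
  fixes t :: real
  assumes "0 \<le> t" "t \<le> 1"
  shows "exp t \<le> 1 + exp 1 * t"
proof -
  have "1 - t \<le> exp (- t)"
    using exp_ge_add_one_self[of "- t"] by simp
  then have "(1 - t) * exp t \<le> exp (- t) * exp t"
    by (intro mult_right_mono) auto
  then have "exp t \<le> 1 + t * exp t"
    by (simp add: exp_minus algebra_simps)
  also have "t * exp t \<le> t * exp 1"
    using assms by (intro mult_left_mono) auto
  finally show ?thesis by (simp add: mult.commute)
qed

text \<open>Combines \<open>t / (1 + t) \<le> ln (1 + t)\<close> with
  \<open>1 + t \<le> 2 \<le> exp 1\<close>. It trades relative increments for logarithms, which
  telescope over the phases. The factor e here and the one in \<open>exp_le_chord\<close> together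
  account for \<open>(exp 1)\<^sup>2\<close> in \<open>mpc_sigma\<close>.\<close>

lemma le_exp_mult_ln:
  fixes t :: real
  assumes "0 \<le> t" "t \<le> 1"
  shows "t \<le> exp 1 * ln (1 + t)"
proof -
  have "1 - 1 / (1 + t) \<le> ln (1 + t)"
    using ln_le_minus_one[of "1 / (1 + t)"] assms by (simp add: ln_div)
  then have "t / (1 + t) \<le> ln (1 + t)"
    using assms by (simp add: field_simps)
  then have "t \<le> (1 + t) * ln (1 + t)"
    using assms by (simp add: field_simps)
  also have "\<dots> \<le> exp 1 * ln (1 + t)"
    using assms exp_ge_add_one_self[of 1] by (intro mult_right_mono) auto
  finally show ?thesis .
qed

section \<open>Counting the variables of a constraint\<close>

lemma inner_vec_sum: "c \<bullet> x = (\<Sum>j\<in>UNIV. c $ j * x $ j)" for c x :: "real^'n"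
  by (simp add: inner_vec_def)

lemma num_vars_le_max_vars_packing: "num_vars (P $ k) \<le> max_vars P C"
  unfolding max_vars_def by (intro Max_ge) auto

lemma num_vars_le_max_vars_covering: "c \<in> set C \<Longrightarrow> num_vars c \<le> max_vars P C"
  unfolding max_vars_def by (intro Max_ge) auto

lemma max_vars_mono: "set C \<subseteq> set D \<Longrightarrow> max_vars P C \<le> max_vars P D"
  unfolding max_vars_def by (intro Max_mono) auto

lemma sum_le_num_vars_mult:
  fixes a :: "real^'n"
  assumes "\<And>j. a $ j \<noteq> 0 \<Longrightarrow> f j \<le> b" and "\<And>j. a $ j = 0 \<Longrightarrow> f j = 0"
  shows "(\<Sum>j\<in>UNIV. f j) \<le> real (num_vars a) * b"
proof -
  have "(\<Sum>j\<in>UNIV. f j) = (\<Sum>j\<in>{j. a $ j \<noteq> 0}. f j)"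
    using assms(2) by (intro sum.mono_neutral_right) auto
  also have "\<dots> \<le> real (card {j. a $ j \<noteq> 0}) * b"
    using assms(1) by (intro sum_bounded_above) auto
  finally show ?thesis by (simp add: num_vars_def)
qed

section \<open>Softmax weights and the log-sum-exp potential\<close>

definition exp_load_sum :: "real^'n^'m \<Rightarrow> real \<Rightarrow> real^'n \<Rightarrow> real" where
  "exp_load_sum P \<Gamma> x = (\<Sum>k\<in>UNIV. exp (((P /\<^sub>R \<Gamma>) *v x) $ k))"

definition softmax_weight :: "real^'n^'m \<Rightarrow> real \<Rightarrow> real^'n \<Rightarrow> 'm \<Rightarrow> real" where
  "softmax_weight P \<Gamma> x k = exp (((P /\<^sub>R \<Gamma>) *v x) $ k) / exp_load_sum P \<Gamma> x"

lemma exp_load_sum_pos: "0 < exp_load_sum P \<Gamma> x"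
  unfolding exp_load_sum_def by (intro sum_pos) auto

lemma mpc_potential_eq: "mpc_potential P \<Gamma> x = ln (exp_load_sum P \<Gamma> x)"
  by (simp add: mpc_potential_def exp_load_sum_def)

lemma mpc_rate_eq: "mpc_rate P \<Gamma> x j = (\<Sum>k\<in>UNIV. (P /\<^sub>R \<Gamma>) $ k $ j * softmax_weight P \<Gamma> x k)"
  by (simp add: mpc_rate_def softmax_weight_def exp_load_sum_def sum_divide_distrib)

lemma softmax_weight_pos: "0 < softmax_weight P \<Gamma> x k"
  by (simp add: softmax_weight_def exp_load_sum_pos)

lemma softmax_weight_nonneg: "0 \<le> softmax_weight P \<Gamma> x k"
  using softmax_weight_pos less_imp_le by blast

lemma sum_softmax_weight: "(\<Sum>k\<in>UNIV. softmax_weight P \<Gamma> x k) = 1"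
  using exp_load_sum_pos[of P \<Gamma> x]
  by (simp add: softmax_weight_def exp_load_sum_def flip: sum_divide_distrib)

lemma load_le_mpc_potential: "((P /\<^sub>R \<Gamma>) *v x) $ k \<le> mpc_potential P \<Gamma> x"
proof -
  have "exp (((P /\<^sub>R \<Gamma>) *v x) $ k) \<le> exp_load_sum P \<Gamma> x"
    unfolding exp_load_sum_def by (intro member_le_sum) auto
  then show ?thesis
    by (simp add: mpc_potential_eq ln_ge_iff exp_load_sum_pos)
qed

lemma scaled_load_le_mpc_potential: "scaled_load P \<Gamma> x \<le> mpc_potential P \<Gamma> x"
  unfolding scaled_load_def by (intro Max.boundedI) (auto simp: load_le_mpc_potential)

lemma mpc_potential_le:
  fixes P :: "real^'n^'m"
  assumes "\<And>k. ((P /\<^sub>R \<Gamma>) *v x) $ k \<le> b"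
  shows "mpc_potential P \<Gamma> x \<le> ln (real CARD('m)) + b"
proof -
  have "exp_load_sum P \<Gamma> x \<le> real CARD('m) * exp b"
    unfolding exp_load_sum_def using assms by (intro sum_bounded_above) auto
  then have "ln (exp_load_sum P \<Gamma> x) \<le> ln (real CARD('m) * exp b)"
    using exp_load_sum_pos[of P \<Gamma> x] by simp
  also have "\<dots> = ln (real CARD('m)) + b"
    by (simp add: ln_mult)
  finally show ?thesis by (simp add: mpc_potential_eq)
qed

lemma load_scaled: "((P /\<^sub>R \<Gamma>) *v x) $ k = (P *v x) $ k / \<Gamma>"
  by (simp add: matrix_vector_mult_def sum_distrib_left divide_inverse mult_ac)

definition ln_em :: "nat \<Rightarrow> real" where
  "ln_em m = ln (exp 1 * real m)"

lemma mpc_mu_eq: "mpc_mu m = 1 + 1 / (3 * ln_em m)"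
  by (simp add: mpc_mu_def ln_em_def)

text \<open>\<open>rate_defined\<close> excludes a variable that occurs in a covering row but in no
  packing row: its rate would be 0, the update would divide by 0, and raising it would cost
  nothing.\<close>

locale mpc_instance =
  fixes P :: "real^'n^'m" and C :: "(real^'n) list" and \<Gamma> :: real
  assumes P_nonneg: "\<And>k j. 0 \<le> P $ k $ j"
    and C_nonneg: "\<And>c j. c \<in> set C \<Longrightarrow> 0 \<le> c $ j"
    and C_nonempty: "C \<noteq> []"
    and feasible: "\<exists>x lam. mpc_feasible P C x lam"
    and rate_defined: "\<And>c j. c \<in> set C \<Longrightarrow> 0 < c $ j \<Longrightarrow> \<exists>k. 0 < P $ k $ j"
    and \<Gamma>_pos: "0 < \<Gamma>"
    and \<Gamma>_lower: "2 * mpc_sigma P C * mpc_opt P C \<le> \<Gamma>"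
begin

abbreviation Q where "Q \<equiv> P /\<^sub>R \<Gamma>"
abbreviation load where "load x k \<equiv> (Q *v x) $ k"
abbreviation rate where "rate \<equiv> mpc_rate P \<Gamma>"
abbreviation \<Phi> where "\<Phi> \<equiv> mpc_potential P \<Gamma>"
abbreviation S where "S \<equiv> exp_load_sum P \<Gamma>"
abbreviation wt where "wt \<equiv> softmax_weight P \<Gamma>"
abbreviation eps where "eps \<equiv> phase_eps P \<Gamma>"
abbreviation upd where "upd \<equiv> phase_update P \<Gamma>"
abbreviation x\<^sub>0 where "x\<^sub>0 \<equiv> mpc_init P C"
abbreviation d where "d \<equiv> real (max_vars P C)"
abbreviation d\<^sub>1 where "d\<^sub>1 \<equiv> real (max_vars P [hd C])"
abbreviation \<rho> where "\<rho> \<equiv> mpc_rho P"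
abbreviation \<kappa> where "\<kappa> \<equiv> mpc_kappa C"
abbreviation \<kappa>\<^sub>1 where "\<kappa>\<^sub>1 \<equiv> mpc_kappa1 C"
abbreviation p_max where "p_max \<equiv> Max {P $ k $ j |k j. True}"
abbreviation p_min where "p_min \<equiv> Min {P $ k $ j |k j. 0 < P $ k $ j}"
abbreviation c_max where "c_max \<equiv> Max {c $ j |c j. c \<in> set C}"
abbreviation c_min where "c_min \<equiv> Min {c $ j |c j. c \<in> set C \<and> 0 < c $ j}"

section \<open>Bounds on the entries and the parameters\<close>

lemma finite_P_entries: "finite {P $ k $ j |k j. R k j}"
proof -
  have "{P $ k $ j |k j. R k j} \<subseteq> (\<lambda>(k, j). P $ k $ j) ` UNIV" by auto
  then show ?thesis by (rule finite_subset) simp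
qed

lemma finite_C_entries: "finite {c $ j |c j. c \<in> set C \<and> R c j}"
proof -
  have "{c $ j |c j. c \<in> set C \<and> R c j} \<subseteq> (\<lambda>(c, j). c $ j) ` (set C \<times> UNIV)" by force
  then show ?thesis by (rule finite_subset) simp
qed

lemma hd_C_in: "hd C \<in> set C"
  using C_nonempty by simp

text \<open>A zero row would have covering value 0 at every point, against feasibility.\<close>

lemma row_has_pos:
  assumes "c \<in> set C" shows "\<exists>j. 0 < c $ j"
proof (rule ccontr)
  assume "\<nexists>j. 0 < c $ j"
  then have "c $ j = 0" for j
    using C_nonneg[OF assms, of j] by (metis less_eq_real_def)
  then have "c \<bullet> x = 0" for x by (simp add: inner_vec_sum)
  then show False using feasible assms by (force simp: mpc_feasible_def)
qed

lemma P_has_pos: "\<exists>k j. 0 < P $ k $ j"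
  using row_has_pos[OF hd_C_in] rate_defined[OF hd_C_in] by blast

lemma p_min_le: "0 < P $ k $ j \<Longrightarrow> p_min \<le> P $ k $ j"
  by (intro Min_le finite_P_entries) auto

lemma p_max_ge: "P $ k $ j \<le> p_max"
  by (intro Max_ge finite_P_entries) auto

lemma p_min_pos: "0 < p_min"
  using P_has_pos finite_P_entries[of "\<lambda>k j. 0 < P $ k $ j"] by (subst Min_gr_iff) auto

lemma p_min_le_p_max: "p_min \<le> p_max"
  using P_has_pos p_min_le p_max_ge order_trans by blast

lemma c_min_le: "c \<in> set C \<Longrightarrow> 0 < c $ j \<Longrightarrow> c_min \<le> c $ j"
  by (intro Min_le finite_C_entries) auto

lemma c_max_ge: "c \<in> set C \<Longrightarrow> c $ j \<le> c_max"
  using finite_C_entries[of "\<lambda>_ _. True"] by (intro Max_ge) auto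

lemma c_min_pos: "0 < c_min"
  using row_has_pos[OF hd_C_in] hd_C_in finite_C_entries[of "\<lambda>c j. 0 < c $ j"]
  by (subst Min_gr_iff) auto

lemma \<kappa>\<^sub>1_ge: "hd C $ j \<le> \<kappa>\<^sub>1"
  unfolding mpc_kappa1_def by (intro Max_ge) auto

lemma c_min_le_\<kappa>\<^sub>1: "c_min \<le> \<kappa>\<^sub>1"
  using row_has_pos[OF hd_C_in] c_min_le[OF hd_C_in] \<kappa>\<^sub>1_ge order_trans by blast

lemma \<kappa>\<^sub>1_le_c_max: "\<kappa>\<^sub>1 \<le> c_max"
  unfolding mpc_kappa1_def by (rule Max.boundedI) (use c_max_ge[OF hd_C_in] in auto)

lemma \<rho>_ge_1: "1 \<le> \<rho>"
  using p_min_pos p_min_le_p_max by (simp add: mpc_rho_def)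

lemma \<kappa>_ge_1: "1 \<le> \<kappa>"
  using c_min_pos c_min_le_\<kappa>\<^sub>1 \<kappa>\<^sub>1_le_c_max by (simp add: mpc_kappa_def)

lemma d\<^sub>1_ge_1: "1 \<le> d\<^sub>1"
proof -
  have "num_vars (hd C) \<noteq> 0"
    using row_has_pos[OF hd_C_in] by (auto simp: num_vars_def less_le)
  then show ?thesis
    using num_vars_le_max_vars_covering[of "hd C" "[hd C]" P] by simp
qed

lemma d\<^sub>1_le_d: "d\<^sub>1 \<le> d"
  using max_vars_mono[of "[hd C]" C P] hd_C_in by simp

lemma ln_em_ge_1: "1 \<le> ln_em CARD('m)"
  by (simp add: ln_em_def ln_mult)

lemma \<mu>_gt_1: "1 < mpc_mu CARD('m)"
  using ln_em_ge_1 by (simp add: mpc_mu_eq)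

lemma \<mu>_le_2: "mpc_mu CARD('m) \<le> 2"
  using ln_em_ge_1 by (simp add: mpc_mu_eq field_simps)

lemma growth_ge: "mpc_mu CARD('m) \<le> mpc_mu CARD('m) * d\<^sup>2 * \<rho> * \<kappa>"
proof -
  have "1 * 1 * 1 \<le> d\<^sup>2 * \<rho> * \<kappa>"
    using d\<^sub>1_ge_1 d\<^sub>1_le_d \<rho>_ge_1 \<kappa>_ge_1 by (intro mult_mono) (auto simp: one_le_power)
  then show ?thesis
    using \<mu>_gt_1 by (simp add: mult.assoc)
qed

text \<open>With L = ln(em),
  \<open>ln \<mu> \<ge> 1 - 1 / \<mu> = 1 / (3 L + 1) \<ge> 1 / (4 L)\<close>, and the 4 is absorbed
  by the square of e. This keeps the scaled load of the starting point small in
  \<open>init_potential_le\<close>.\<close>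

lemma \<sigma>_ge: "1 / ln_em CARD('m) \<le> mpc_sigma P C"
proof -
  have "1 / (4 * ln_em CARD('m)) \<le> 1 / (3 * ln_em CARD('m) + 1)"
    using ln_em_ge_1 by (intro divide_left_mono) auto
  also have "\<dots> = 1 - 1 / mpc_mu CARD('m)"
    using ln_em_ge_1 by (simp add: mpc_mu_eq field_simps)
  also have "\<dots> \<le> ln (mpc_mu CARD('m))"
    using ln_le_minus_one[of "1 / mpc_mu CARD('m)"] \<mu>_gt_1 by (simp add: ln_div)
  also have "\<dots> \<le> ln (mpc_mu CARD('m) * d\<^sup>2 * \<rho> * \<kappa>)"
    using growth_ge \<mu>_gt_1 by (intro ln_mono) auto
  finally have *: "1 / (4 * ln_em CARD('m)) \<le> ln (mpc_mu CARD('m) * d\<^sup>2 * \<rho> * \<kappa>)" .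
  have "2\<^sup>2 \<le> (exp 1 :: real)\<^sup>2"
    using exp_ge_add_one_self[of 1] by (intro power_mono) auto
  then have "4 * (1 / (4 * ln_em CARD('m))) \<le> (exp 1)\<^sup>2 * ln (mpc_mu CARD('m) * d\<^sup>2 * \<rho> * \<kappa>)"
    using * ln_em_ge_1 by (intro mult_mono) auto
  then show ?thesis by (simp add: mpc_sigma_def)
qed

lemma \<sigma>_pos: "0 < mpc_sigma P C"
  using \<sigma>_ge ln_em_ge_1 by (smt (verit) divide_pos_pos)

section \<open>The starting point and a lower bound on the optimum\<close>

lemma x\<^sub>0_component: "x\<^sub>0 $ j = 1 / (d\<^sub>1\<^sup>2 * \<rho> * \<kappa>\<^sub>1)"
  by (simp add: mpc_init_def)

lemma \<kappa>\<^sub>1_pos: "0 < \<kappa>\<^sub>1"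
  using c_min_pos c_min_le_\<kappa>\<^sub>1 by linarith

lemma init_denominator_pos: "0 < d\<^sub>1\<^sup>2 * \<rho> * \<kappa>\<^sub>1"
  using d\<^sub>1_ge_1 \<rho>_ge_1 \<kappa>\<^sub>1_pos by (intro mult_pos_pos zero_less_power) linarith+

lemma x\<^sub>0_pos: "0 < x\<^sub>0 $ j"
  unfolding x\<^sub>0_component using init_denominator_pos by (rule divide_pos_pos[OF zero_less_one])

lemma x\<^sub>0_le: "x\<^sub>0 $ j \<le> mpc_mu CARD('m) / c_min"
proof -
  have "1 * 1 * c_min \<le> d\<^sub>1\<^sup>2 * \<rho> * \<kappa>\<^sub>1"
    using d\<^sub>1_ge_1 \<rho>_ge_1 c_min_le_\<kappa>\<^sub>1 c_min_pos by (intro mult_mono) (auto simp: one_le_power)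
  then have "x\<^sub>0 $ j \<le> 1 / c_min"
    unfolding x\<^sub>0_component using c_min_pos init_denominator_pos
    by (intro divide_left_mono mult_pos_pos[OF _ c_min_pos]) auto
  also have "\<dots> \<le> mpc_mu CARD('m) / c_min"
    using \<mu>_gt_1 c_min_pos by (intro divide_right_mono) auto
  finally show ?thesis .
qed

lemma growth_bound:
  assumes "x\<^sub>0 $ j \<le> x $ j" "x $ j \<le> mpc_mu CARD('m) / c_min"
  shows "ln (x $ j / x\<^sub>0 $ j) \<le> mpc_sigma P C / (exp 1)\<^sup>2"
proof -
  have "x $ j / x\<^sub>0 $ j \<le> (mpc_mu CARD('m) / c_min) / x\<^sub>0 $ j"
    using assms x\<^sub>0_pos[of j] by (intro divide_right_mono) auto
  \<comment> \<open>The reciprocal of the starting value contributes all factors except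
    \<open>\<mu> / c_min\<close>; \<open>\<kappa>\<^sub>1 / c_min\<close> is then at most
    \<open>\<kappa>\<close>.\<close>
  also have "\<dots> = mpc_mu CARD('m) * d\<^sub>1\<^sup>2 * \<rho> * (\<kappa>\<^sub>1 / c_min)"
    by (simp add: x\<^sub>0_component)
  also have "\<dots> \<le> mpc_mu CARD('m) * d\<^sup>2 * \<rho> * \<kappa>"
    unfolding mpc_kappa_def using \<mu>_gt_1 d\<^sub>1_ge_1 d\<^sub>1_le_d \<rho>_ge_1 \<kappa>\<^sub>1_pos \<kappa>\<^sub>1_le_c_max c_min_pos
    by (intro mult_mono divide_right_mono power_mono) auto
  finally have "ln (x $ j / x\<^sub>0 $ j) \<le> ln (mpc_mu CARD('m) * d\<^sup>2 * \<rho> * \<kappa>)"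
    using assms x\<^sub>0_pos[of j] by (intro ln_mono) (auto intro: divide_pos_pos)
  then show ?thesis by (simp add: mpc_sigma_def)
qed

text \<open>Every variable of the first covering row has a packing entry of at least
  \<open>p_min\<close>, so \<open>p_min * x $ j \<le> lam\<close>. The row has at most
  \<open>d\<^sub>1\<close> variables with coefficients at most \<open>\<kappa>\<^sub>1\<close>, yet
  must reach 1.\<close>

lemma p_min_le_mult_lam:
  assumes "mpc_feasible P C x lam"
  shows "p_min \<le> d\<^sub>1 * \<kappa>\<^sub>1 * lam"
proof -
  let ?c = "hd C"
  have x: "0 \<le> x $ j" and lam: "(P *v x) $ k \<le> lam" and c: "1 \<le> ?c \<bullet> x" for j k
    using assms hd_C_in by (auto simp: mpc_feasible_def)
  have *: "p_min * x $ j \<le> lam" if "?c $ j \<noteq> 0" for j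
  proof -
    have "0 < ?c $ j" using that C_nonneg[OF hd_C_in, of j] by linarith
    then obtain k where k: "0 < P $ k $ j" using rate_defined[OF hd_C_in] by blast
    have "p_min * x $ j \<le> P $ k $ j * x $ j"
      using p_min_le[OF k] x by (intro mult_right_mono) auto
    also have "\<dots> \<le> (\<Sum>j\<in>UNIV. P $ k $ j * x $ j)"
      using P_nonneg x by (intro member_le_sum) auto
    also have "\<dots> \<le> lam" using lam[of k] by (simp add: matrix_vector_mult_def)
    finally show ?thesis .
  qed
  have lam0: "0 \<le> lam"
  proof -
    \<comment> \<open>Here \<open>undefined\<close> just names some packing row; any row would
      do.\<close>
    have "0 \<le> (P *v x) $ undefined"
      using P_nonneg x by (auto simp: matrix_vector_mult_def intro!: sum_nonneg)
    then show ?thesis using lam[of undefined] by linarith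
  qed
  have "p_min \<le> p_min * (?c \<bullet> x)"
    using c p_min_pos by simp
  also have "\<dots> = (\<Sum>j\<in>UNIV. ?c $ j * (p_min * x $ j))"
    unfolding inner_vec_sum sum_distrib_left by (simp add: mult_ac)
  also have "\<dots> \<le> real (num_vars ?c) * (\<kappa>\<^sub>1 * lam)"
    using * \<kappa>\<^sub>1_ge C_nonneg[OF hd_C_in] x p_min_pos \<kappa>\<^sub>1_pos
    by (intro sum_le_num_vars_mult mult_mono) auto
  also have "\<dots> \<le> d\<^sub>1 * (\<kappa>\<^sub>1 * lam)"
    using num_vars_le_max_vars_covering[of ?c "[?c]" P] \<kappa>\<^sub>1_pos lam0
    by (intro mult_right_mono) auto
  finally show ?thesis by (simp add: mult.assoc)
qed

text \<open>A lower bound on all feasible values passes to the infimum, so no optimal solution has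
  to be chosen.\<close>

lemma le_mpc_optI:
  assumes "\<And>x lam. mpc_feasible P C x lam \<Longrightarrow> b \<le> lam"
  shows "b \<le> mpc_opt P C"
  unfolding mpc_opt_def using feasible assms by (intro cInf_greatest) auto

lemma opt_lower: "p_min / (d\<^sub>1 * \<kappa>\<^sub>1) \<le> mpc_opt P C"
  using p_min_le_mult_lam d\<^sub>1_ge_1 \<kappa>\<^sub>1_pos
  by (intro le_mpc_optI) (auto simp: field_simps)

lemma opt_scaled_le: "mpc_opt P C / \<Gamma> \<le> 1 / (2 * mpc_sigma P C)"
  using \<Gamma>_lower \<Gamma>_pos \<sigma>_pos by (simp add: field_simps)

text \<open>A packing row has at most \<open>d\<^sub>1\<close> entries, each at most
  \<open>p_max\<close>. Dividing by \<open>d\<^sub>1\<^sup>2 * \<rho> * \<kappa>\<^sub>1\<close>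
  cancels one \<open>d\<^sub>1\<close> and turns \<open>p_max\<close> into \<open>p_min\<close>,
  which gives exactly the bound of \<open>opt_lower\<close>.\<close>

lemma init_load_le: "(P *v x\<^sub>0) $ k \<le> mpc_opt P C"
proof -
  have "(P *v x\<^sub>0) $ k = (\<Sum>j\<in>UNIV. P $ k $ j * (1 / (d\<^sub>1\<^sup>2 * \<rho> * \<kappa>\<^sub>1)))"
    by (simp add: matrix_vector_mult_def x\<^sub>0_component)
  also have "\<dots> \<le> real (num_vars (P $ k)) * (p_max * (1 / (d\<^sub>1\<^sup>2 * \<rho> * \<kappa>\<^sub>1)))"
    using p_max_ge x\<^sub>0_pos[of undefined]
    by (intro sum_le_num_vars_mult mult_right_mono) (auto simp: x\<^sub>0_component)
  also have "\<dots> \<le> d\<^sub>1 * (p_max * (1 / (d\<^sub>1\<^sup>2 * \<rho> * \<kappa>\<^sub>1)))"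
    using num_vars_le_max_vars_packing[of P k "[hd C]"] x\<^sub>0_pos[of undefined] p_min_pos p_min_le_p_max
    by (intro mult_right_mono) (auto simp: x\<^sub>0_component)
  also have "\<dots> = p_min / (d\<^sub>1 * \<kappa>\<^sub>1)"
    using p_min_pos p_min_le_p_max \<kappa>\<^sub>1_pos d\<^sub>1_ge_1
    by (simp add: mpc_rho_def field_simps power2_eq_square)
  finally show ?thesis using opt_lower by linarith
qed

text \<open>The added 1 is room for the total increase of the potential during the run.\<close>

lemma init_potential_le: "\<Phi> x\<^sub>0 + 1 \<le> 2 * ln_em CARD('m)"
proof -
  have "load x\<^sub>0 k \<le> 1 / (2 * mpc_sigma P C)" for k
    using opt_scaled_le divide_right_mono[OF init_load_le, of \<Gamma> k] \<Gamma>_pos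
    by (simp add: load_scaled)
  then have "\<Phi> x\<^sub>0 \<le> ln (real CARD('m)) + 1 / (2 * mpc_sigma P C)"
    by (rule mpc_potential_le)
  moreover have "1 / (2 * mpc_sigma P C) \<le> ln_em CARD('m)"
  proof -
    have "1 \<le> ln_em CARD('m) * mpc_sigma P C" using \<sigma>_ge ln_em_ge_1 by (simp add: field_simps)
    then show ?thesis using \<sigma>_pos by (simp add: field_simps)
  qed
  moreover have "ln_em CARD('m) = 1 + ln (real CARD('m))" by (simp add: ln_em_def ln_mult)
  ultimately show ?thesis by linarith
qed

section \<open>Rates and step sizes of a phase\<close>

lemma Q_nonneg: "0 \<le> Q $ k $ j"
  using P_nonneg \<Gamma>_pos by simp

lemma rate_nonneg: "0 \<le> rate x j"
  unfolding mpc_rate_eq using Q_nonneg softmax_weight_nonneg by (intro sum_nonneg mult_nonneg_nonneg) auto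

lemma rate_pos:
  assumes "c \<in> set C" "0 < c $ j"
  shows "0 < rate x j"
proof -
  obtain k where "0 < P $ k $ j" using rate_defined assms by blast
  then have "0 < Q $ k $ j * wt x k"
    using \<Gamma>_pos softmax_weight_pos[of P \<Gamma> x k] by simp
  also have "\<dots> \<le> rate x j"
    unfolding mpc_rate_eq using Q_nonneg softmax_weight_nonneg
    by (intro member_le_sum mult_nonneg_nonneg) auto
  finally show ?thesis .
qed

text \<open>That the minimum is attained gives progress in each phase (\<open>incr_eq_max\<close>);
  that it is a lower bound caps the growth of every variable (\<open>incr_le\<close>).\<close>

lemma eps_eq:
  assumes "c \<in> set C"
  shows "\<exists>j. 0 < c $ j \<and> eps c x = (mpc_mu CARD('m) - 1) * (rate x j / c $ j)"
    and "0 < c $ j \<Longrightarrow> eps c x \<le> (mpc_mu CARD('m) - 1) * (rate x j / c $ j)"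
proof -
  let ?A = "{rate x j / c $ j |j. 0 < c $ j}"
  have fin: "finite ?A" by simp
  have "?A \<noteq> {}" using row_has_pos[OF assms] by blast
  then have "Min ?A \<in> ?A" using fin by (rule Min_in[rotated])
  then show "\<exists>j. 0 < c $ j \<and> eps c x = (mpc_mu CARD('m) - 1) * (rate x j / c $ j)"
    unfolding phase_eps_def by auto
  assume "0 < c $ j"
  then have "Min ?A \<le> rate x j / c $ j" using fin by (intro Min_le) auto
  then show "eps c x \<le> (mpc_mu CARD('m) - 1) * (rate x j / c $ j)"
    unfolding phase_eps_def using \<mu>_gt_1 by (intro mult_left_mono) auto
qed

lemma eps_pos: "c \<in> set C \<Longrightarrow> 0 < eps c x"
  using eps_eq(1)[of c x] \<mu>_gt_1 rate_pos by fastforce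

definition incr :: "real^'n \<Rightarrow> real^'n \<Rightarrow> 'n \<Rightarrow> real" where
  "incr c x j = eps c x * c $ j / rate x j"

lemma upd_component: "upd c x $ j = x $ j * (1 + incr c x j)"
  by (simp add: phase_update_def incr_def)

lemma incr_nonneg: "c \<in> set C \<Longrightarrow> 0 \<le> incr c x j"
  unfolding incr_def using eps_pos C_nonneg rate_nonneg by (simp add: less_imp_le)

lemma incr_le:
  assumes "c \<in> set C" shows "incr c x j \<le> mpc_mu CARD('m) - 1"
proof (cases "c $ j = 0")
  case True
  then show ?thesis using \<mu>_gt_1 by (simp add: incr_def)
next
  case False
  then have "0 < c $ j" using C_nonneg[OF assms, of j] by linarith
  then show ?thesis
    using eps_eq(2)[OF assms, of j x] rate_pos[OF assms, of j x]
    by (simp add: incr_def field_simps)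
qed

text \<open>If \<open>c $ j = 0\<close>, both sides vanish; otherwise the rate is positive and
  cancels.\<close>

lemma rate_mult_incr: "c \<in> set C \<Longrightarrow> rate x j * incr c x j = eps c x * c $ j"
  using rate_pos[of c j x] C_nonneg[of c j] by (cases "c $ j = 0") (auto simp: incr_def)

lemma incr_eq_max:
  assumes "c \<in> set C" shows "\<exists>j. incr c x j = mpc_mu CARD('m) - 1"
proof -
  obtain j where j: "0 < c $ j" "eps c x = (mpc_mu CARD('m) - 1) * (rate x j / c $ j)"
    using eps_eq(1)[OF assms] by blast
  then show ?thesis
    using rate_pos[OF assms j(1), of x] by (intro exI[of _ j]) (simp add: incr_def)
qed

section \<open>The range of the variables\<close>

definition bounded_config :: "real^'n \<Rightarrow> bool" where
  "bounded_config x \<longleftrightarrow> (\<forall>j. x\<^sub>0 $ j \<le> x $ j \<and> x $ j \<le> mpc_mu CARD('m) / c_min)"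

lemma bounded_config_pos: "bounded_config x \<Longrightarrow> 0 < x $ j"
  using x\<^sub>0_pos by (metis bounded_config_def less_le_trans)

lemma bounded_config_nonneg: "bounded_config x \<Longrightarrow> 0 \<le> x $ j"
  using bounded_config_pos less_imp_le by blast

lemma le_upd: "bounded_config x \<Longrightarrow> c \<in> set C \<Longrightarrow> x $ j \<le> upd c x $ j"
  using incr_nonneg[of c x j] bounded_config_pos[of x j] by (simp add: upd_component)

text \<open>A variable grows only in a phase for a row containing it that is still below 1. Hence it
  is at most \<open>1 / c_min\<close> before the phase, and one phase multiplies it by at most
  \<open>\<mu>\<close>.\<close>

lemma bounded_config_upd:
  assumes x: "bounded_config x" and c: "c \<in> set C" and unsat: "c \<bullet> x < 1"
  shows "bounded_config (upd c x)"
  unfolding bounded_config_def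
proof (intro allI conjI)
  fix j
  show "x\<^sub>0 $ j \<le> upd c x $ j"
    using le_upd[OF x c, of j] x by (auto simp: bounded_config_def intro: order_trans)
  show "upd c x $ j \<le> mpc_mu CARD('m) / c_min"
  proof (cases "c $ j = 0")
    case True
    then show ?thesis using x by (simp add: upd_component incr_def bounded_config_def)
  next
    case False
    then have cj: "0 < c $ j" using C_nonneg[OF c, of j] by linarith
    have "c $ j * x $ j \<le> c \<bullet> x"
      unfolding inner_vec_sum using C_nonneg[OF c] bounded_config_nonneg[OF x]
      by (intro member_le_sum mult_nonneg_nonneg) auto
    then have "c_min * x $ j \<le> 1"
      using unsat c_min_le[OF c cj] mult_right_mono[of c_min "c $ j" "x $ j"] bounded_config_pos[OF x, of j]
      by linarith
    then have "x $ j \<le> 1 / c_min" using c_min_pos by (simp add: field_simps)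
    then have "x $ j * (1 + incr c x j) \<le> (1 / c_min) * mpc_mu CARD('m)"
      using incr_le[OF c, of x j] incr_nonneg[OF c, of x j] c_min_pos by (intro mult_mono) auto
    then show ?thesis by (simp add: upd_component)
  qed
qed

section \<open>Loads, potential and softmax weights in one phase\<close>

lemma load_upd:
  "load (upd c x) k = load x k + (\<Sum>j\<in>UNIV. Q $ k $ j * (x $ j * incr c x j))"
  by (simp add: matrix_vector_mult_def upd_component sum.distrib[symmetric] algebra_simps)

lemma load_upd_ge:
  assumes "bounded_config x" "c \<in> set C"
  shows "load x k \<le> load (upd c x) k"
  unfolding load_upd le_add_same_cancel1
  using Q_nonneg bounded_config_nonneg[OF assms(1)] incr_nonneg[OF assms(2)]
  by (intro sum_nonneg mult_nonneg_nonneg) auto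

text \<open>Each load grows by at most the fraction \<open>\<mu> - 1 = 1 / (3 L)\<close> of itself,
  with L = ln(em). The value of \<open>\<mu>\<close> is chosen so that loads up to the failure
  threshold \<open>3 L\<close> grow by at most 1.\<close>

lemma load_upd_le:
  assumes x: "bounded_config x" and c: "c \<in> set C" and load: "load x k \<le> 3 * ln_em CARD('m)"
  shows "load (upd c x) k - load x k \<le> 1"
proof -
  have "load (upd c x) k - load x k = (\<Sum>j\<in>UNIV. Q $ k $ j * (x $ j * incr c x j))"
    by (simp add: load_upd)
  also have "\<dots> \<le> (\<Sum>j\<in>UNIV. Q $ k $ j * (x $ j * (mpc_mu CARD('m) - 1)))"
    using Q_nonneg bounded_config_nonneg[OF x] incr_le[OF c]
    by (intro sum_mono mult_left_mono) auto
  also have "\<dots> = (mpc_mu CARD('m) - 1) * load x k"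
    by (simp add: matrix_vector_mult_def sum_distrib_left mult_ac)
  also have "\<dots> \<le> (mpc_mu CARD('m) - 1) * (3 * ln_em CARD('m))"
    using load \<mu>_gt_1 by (intro mult_left_mono) auto
  also have "\<dots> = 1" using ln_em_ge_1 by (simp add: mpc_mu_eq)
  finally show ?thesis .
qed

lemma S_upd_ge: "bounded_config x \<Longrightarrow> c \<in> set C \<Longrightarrow> S x \<le> S (upd c x)"
  unfolding exp_load_sum_def by (intro sum_mono) (simp add: load_upd_ge)

text \<open>
  The load increments are at most 1, so the chord bound for the exponential applies, and the
  first-order increase of \<open>\<Phi>\<close> is \<open>\<epsilon>\<close> times the covering value, which is still below 1.
\<close>

lemma potential_upd_le:
  assumes x: "bounded_config x" and c: "c \<in> set C" and unsat: "c \<bullet> x < 1"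
    and load: "\<And>k. load x k \<le> 3 * ln_em CARD('m)"
  shows "\<Phi> (upd c x) \<le> \<Phi> x + exp 1 * eps c x"
proof -
  define \<delta> where "\<delta> k = load (upd c x) k - load x k" for k
  have \<delta>: "0 \<le> \<delta> k" "\<delta> k \<le> 1" for k
    using load_upd_ge[OF x c] load_upd_le[OF x c load] by (auto simp: \<delta>_def)
  have "(\<Sum>k\<in>UNIV. exp (load x k) * \<delta> k) = S x * (\<Sum>k\<in>UNIV. wt x k * \<delta> k)"
    using exp_load_sum_pos[of P \<Gamma> x] by (simp add: softmax_weight_def sum_distrib_left)
  also have "(\<Sum>k\<in>UNIV. wt x k * \<delta> k) = (\<Sum>k\<in>UNIV. \<Sum>j\<in>UNIV. x $ j * incr c x j * (Q $ k $ j * wt x k))"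
    by (simp add: \<delta>_def load_upd sum_distrib_left mult_ac)
  \<comment> \<open>Exchanging the sums assembles the weights into rates, which then cancel against
    the denominators of \<open>incr\<close>.\<close>
  also have "\<dots> = (\<Sum>j\<in>UNIV. x $ j * incr c x j * rate x j)"
    by (subst sum.swap) (simp add: mpc_rate_eq sum_distrib_left)
  also have "\<dots> = eps c x * (c \<bullet> x)"
    using rate_mult_incr[OF c, of x] by (simp add: inner_vec_sum sum_distrib_left mult_ac)
  finally have lin: "(\<Sum>k\<in>UNIV. exp (load x k) * \<delta> k) = S x * (eps c x * (c \<bullet> x))" .
  have "S (upd c x) = (\<Sum>k\<in>UNIV. exp (load x k) * exp (\<delta> k))"
    by (simp add: exp_load_sum_def \<delta>_def flip: exp_add)
  also have "\<dots> \<le> (\<Sum>k\<in>UNIV. exp (load x k) * (1 + exp 1 * \<delta> k))"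
    using \<delta> by (intro sum_mono mult_left_mono exp_le_chord) auto
  also have "\<dots> = S x + exp 1 * (\<Sum>k\<in>UNIV. exp (load x k) * \<delta> k)"
    by (simp add: exp_load_sum_def sum.distrib sum_distrib_left distrib_left distrib_right mult_ac)
  also have "\<dots> = S x * (1 + exp 1 * (eps c x * (c \<bullet> x)))"
    unfolding lin by (simp add: algebra_simps)
  also have "\<dots> \<le> S x * (1 + exp 1 * (eps c x * 1))"
    using exp_load_sum_pos[of P \<Gamma> x] eps_pos[OF c, of x] unsat by (simp add: mult_le_cancel_left)
  also have "\<dots> \<le> S x * exp (exp 1 * eps c x)"
    using exp_load_sum_pos[of P \<Gamma> x] exp_ge_add_one_self[of "exp 1 * eps c x"] by simp
  finally have "ln (S (upd c x)) \<le> ln (S x * exp (exp 1 * eps c x))"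
    using exp_load_sum_pos by (intro ln_mono) auto
  then show ?thesis
    using exp_load_sum_pos[of P \<Gamma> x] by (simp add: mpc_potential_eq ln_mult)
qed

text \<open>Since \<open>S\<close> does not decrease, a weight rises by at most the increase of its
  exponential over the new \<open>S\<close>. These bounds sum to \<open>1 - S x / S ?x'\<close>,
  which is at most the increase of \<open>ln S\<close>.\<close>

lemma sum_weight_increase_le:
  assumes x: "bounded_config x" and c: "c \<in> set C"
  shows "(\<Sum>k\<in>UNIV. max 0 (wt (upd c x) k - wt x k)) \<le> \<Phi> (upd c x) - \<Phi> x"
proof -
  let ?x' = "upd c x"
  have S: "0 < S x" "0 < S ?x'" "S x \<le> S ?x'"
    using exp_load_sum_pos S_upd_ge[OF x c] by auto
  have "max 0 (wt ?x' k - wt x k) \<le> (exp (load ?x' k) - exp (load x k)) / S ?x'" for k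
  proof -
    have "exp (load x k) / S ?x' \<le> wt x k"
      unfolding softmax_weight_def using S by (intro divide_left_mono) auto
    moreover have "0 \<le> (exp (load ?x' k) - exp (load x k)) / S ?x'"
      using load_upd_ge[OF x c, of k] S by auto
    ultimately show ?thesis by (simp add: softmax_weight_def diff_divide_distrib)
  qed
  then have "(\<Sum>k\<in>UNIV. max 0 (wt ?x' k - wt x k)) \<le> (\<Sum>k\<in>UNIV. (exp (load ?x' k) - exp (load x k)) / S ?x')"
    by (intro sum_mono)
  also have "\<dots> = (S ?x' - S x) / S ?x'"
    by (simp add: exp_load_sum_def sum_subtractf flip: sum_divide_distrib)
  also have "\<dots> = 1 - S x / S ?x'" using S by (simp add: field_simps)
  also have "\<dots> \<le> - ln (S x / S ?x')"
    using ln_le_minus_one[of "S x / S ?x'"] S by simp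
  also have "\<dots> = \<Phi> ?x' - \<Phi> x"
    using S by (simp add: mpc_potential_eq ln_div)
  finally show ?thesis .
qed

section \<open>The dual certificate and the bound on the potential\<close>

text \<open>
  Here \<open>E\<close> is the sum of all step sizes \<open>\<epsilon>\<close> so far, \<open>G j\<close> the sum of all \<open>\<epsilon> c\<^sub>i\<^sub>j\<close>, and \<open>M k\<close> the
  running maximum of the softmax weight of packing constraint \<open>k\<close>. The rates are not monotone
  in time; the vector \<open>M\<close> replaces the packing dual so that a single vector dominates all of them.
\<close>

definition dual_certificate :: "real^'n \<Rightarrow> real \<Rightarrow> ('n \<Rightarrow> real) \<Rightarrow> ('m \<Rightarrow> real) \<Rightarrow> bool" where
  "dual_certificate x E G M \<longleftrightarrow>
     \<Phi> x \<le> \<Phi> x\<^sub>0 + exp 1 * E \<and>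
     (\<forall>k. wt x k \<le> M k) \<and>
     (\<Sum>k\<in>UNIV. M k) \<le> 1 + (\<Phi> x - \<Phi> x\<^sub>0) \<and>
     (\<forall>j. G j \<le> exp 1 * (\<Sum>k\<in>UNIV. Q $ k $ j * M k) * ln (x $ j / x\<^sub>0 $ j)) \<and>
     (\<forall>xs lam. mpc_feasible P C xs lam \<longrightarrow> E \<le> (\<Sum>j\<in>UNIV. xs $ j * G j))"

lemma dual_certificate_init: "dual_certificate x\<^sub>0 0 (\<lambda>_. 0) (wt x\<^sub>0)"
  by (simp add: dual_certificate_def sum_softmax_weight x\<^sub>0_pos less_imp_neq[OF x\<^sub>0_pos, symmetric])

lemma dual_certificate_upd:
  assumes x: "bounded_config x" and c: "c \<in> set C" and unsat: "c \<bullet> x < 1"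
    and load: "\<And>k. load x k \<le> 3 * ln_em CARD('m)" and cert: "dual_certificate x E G M"
  shows "dual_certificate (upd c x) (E + eps c x) (\<lambda>j. G j + eps c x * c $ j)
           (\<lambda>k. max (M k) (wt (upd c x) k))"
proof -
  let ?x' = "upd c x" and ?M = "\<lambda>k. max (M k) (wt (upd c x) k)"
  have \<Phi>: "\<Phi> x \<le> \<Phi> x\<^sub>0 + exp 1 * E"
    and M: "\<And>k. wt x k \<le> M k"
    and sumM: "(\<Sum>k\<in>UNIV. M k) \<le> 1 + (\<Phi> x - \<Phi> x\<^sub>0)"
    and G: "\<And>j. G j \<le> exp 1 * (\<Sum>k\<in>UNIV. Q $ k $ j * M k) * ln (x $ j / x\<^sub>0 $ j)"
    and E: "\<And>xs lam. mpc_feasible P C xs lam \<Longrightarrow> E \<le> (\<Sum>j\<in>UNIV. xs $ j * G j)"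
    using cert by (auto simp: dual_certificate_def)
  have "\<Phi> ?x' \<le> \<Phi> x\<^sub>0 + exp 1 * (E + eps c x)"
    using potential_upd_le[OF x c unsat load] \<Phi> by (simp add: algebra_simps)
  moreover have "(\<Sum>k\<in>UNIV. ?M k) \<le> 1 + (\<Phi> ?x' - \<Phi> x\<^sub>0)"
  proof -
    have "?M k \<le> M k + max 0 (wt ?x' k - wt x k)" for k
      using M[of k] by linarith
    then have "(\<Sum>k\<in>UNIV. ?M k) \<le> (\<Sum>k\<in>UNIV. M k) + (\<Sum>k\<in>UNIV. max 0 (wt ?x' k - wt x k))"
      unfolding sum.distrib[symmetric] by (intro sum_mono)
    then show ?thesis using sum_weight_increase_le[OF x c] sumM by linarith
  qed
  moreover have "G j + eps c x * c $ j \<le> exp 1 * (\<Sum>k\<in>UNIV. Q $ k $ j * ?M k) * ln (?x' $ j / x\<^sub>0 $ j)" for j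
  proof -
    let ?R = "\<Sum>k\<in>UNIV. Q $ k $ j * M k" and ?R' = "\<Sum>k\<in>UNIV. Q $ k $ j * ?M k"
    have RR: "?R \<le> ?R'"
      using Q_nonneg by (intro sum_mono mult_left_mono) auto
    \<comment> \<open>The rate varies with \<open>x\<close>, but its weights are dominated by the
      running maxima.\<close>
    have rR: "rate x j \<le> ?R'"
      unfolding mpc_rate_eq using Q_nonneg M
      by (intro sum_mono mult_left_mono) (auto simp: le_max_iff_disj)
    have pos: "0 < x $ j" "0 < x\<^sub>0 $ j" "x\<^sub>0 $ j \<le> x $ j"
      using bounded_config_pos[OF x] x\<^sub>0_pos x by (auto simp: bounded_config_def)
    have t: "0 \<le> incr c x j" "incr c x j \<le> 1"
      using incr_nonneg[OF c] incr_le[OF c, of x j] \<mu>_le_2 by auto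
    have "eps c x * c $ j = rate x j * incr c x j" by (simp add: rate_mult_incr[OF c])
    also have "\<dots> \<le> ?R' * (exp 1 * ln (1 + incr c x j))"
      using rR t rate_nonneg[of x j] by (intro mult_mono le_exp_mult_ln) auto
    finally have "eps c x * c $ j \<le> exp 1 * ?R' * ln (1 + incr c x j)" by (simp add: mult_ac)
    moreover have "G j \<le> exp 1 * ?R' * ln (x $ j / x\<^sub>0 $ j)"
      by (rule order_trans[OF G]) (use RR pos in \<open>intro mult_right_mono mult_left_mono, auto\<close>)
    \<comment> \<open>The logarithms telescope, so the old and the new share of \<open>G\<close> add
      up under the common factor \<open>?R'\<close>.\<close>
    moreover have "ln (?x' $ j / x\<^sub>0 $ j) = ln (x $ j / x\<^sub>0 $ j) + ln (1 + incr c x j)"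
      using pos t by (simp add: upd_component ln_mult ln_div)
    ultimately show ?thesis by (simp add: algebra_simps)
  qed
  \<comment> \<open>Any feasible \<open>xs\<close> covers the row \<open>c\<close>, so weighting the
    new share of \<open>G\<close> by \<open>xs\<close> recovers at least
    \<open>eps c x\<close>.\<close>
  moreover have "E + eps c x \<le> (\<Sum>j\<in>UNIV. xs $ j * (G j + eps c x * c $ j))"
    if xs: "mpc_feasible P C xs lam" for xs lam
  proof -
    have "1 \<le> c \<bullet> xs" using xs c by (auto simp: mpc_feasible_def)
    then have "eps c x \<le> eps c x * (c \<bullet> xs)" using eps_pos[OF c, of x] by simp
    also have "\<dots> = (\<Sum>j\<in>UNIV. xs $ j * (eps c x * c $ j))"
      by (simp add: inner_vec_sum sum_distrib_left mult_ac)
    finally show ?thesis using E[OF xs] by (simp add: distrib_left sum.distrib)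
  qed
  ultimately show ?thesis
    unfolding dual_certificate_def by (intro conjI allI impI) (blast intro: max.cobounded2)+
qed

lemma dual_certificate_potential_le:
  assumes x: "bounded_config x" and cert: "dual_certificate x E G M"
  shows "\<Phi> x \<le> 2 * ln_em CARD('m)"
proof -
  define D where "D = \<Phi> x - \<Phi> x\<^sub>0"
  have M: "\<And>k. wt x k \<le> M k"
    and sumM: "(\<Sum>k\<in>UNIV. M k) \<le> 1 + D"
    and G: "\<And>j. G j \<le> exp 1 * (\<Sum>k\<in>UNIV. Q $ k $ j * M k) * ln (x $ j / x\<^sub>0 $ j)"
    and E: "\<And>xs lam. mpc_feasible P C xs lam \<Longrightarrow> E \<le> (\<Sum>j\<in>UNIV. xs $ j * G j)"
    and DE: "D \<le> exp 1 * E"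
    using cert by (auto simp: dual_certificate_def D_def)
  have M0: "0 \<le> M k" for k using M[of k] softmax_weight_pos[of P \<Gamma> x k] by linarith
  \<comment> \<open>The weights sum to 1 and lie below \<open>M\<close>, whose sum is at most
    \<open>1 + D\<close>.\<close>
  have D1: "0 < 1 + D"
    using sumM sum_mono[of UNIV "wt x" M, OF M] sum_softmax_weight[of P \<Gamma> x] by linarith
  let ?\<sigma> = "mpc_sigma P C"
  \<comment> \<open>Weak duality with multipliers \<open>M\<close>, solved for \<open>lam\<close> so
    that \<open>le_mpc_optI\<close> carries it over to the optimum.\<close>
  have "D * \<Gamma> / (?\<sigma> * (1 + D)) \<le> lam" if xs: "mpc_feasible P C xs lam" for xs lam
  proof -
    have xs0: "0 \<le> xs $ j" and lam: "load xs k \<le> lam / \<Gamma>" for j k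
      using xs \<Gamma>_pos by (auto simp: mpc_feasible_def load_scaled divide_right_mono)
    have G': "G j \<le> exp 1 * (\<Sum>k\<in>UNIV. Q $ k $ j * M k) * (?\<sigma> / (exp 1)\<^sup>2)" for j
    proof -
      have "0 \<le> (\<Sum>k\<in>UNIV. Q $ k $ j * M k)"
        using Q_nonneg M0 by (intro sum_nonneg mult_nonneg_nonneg)
      then show ?thesis
        using growth_bound[of j x] x
        by (intro order_trans[OF G] mult_left_mono) (auto simp: bounded_config_def)
    qed
    have lam0: "0 \<le> lam / \<Gamma>"
    proof -
      have "0 \<le> load xs undefined"
        unfolding matrix_vector_mult_def using xs0 Q_nonneg
        by (simp only: vec_lambda_beta) (intro sum_nonneg mult_nonneg_nonneg)
      then show ?thesis using lam[of undefined] by linarith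
    qed
    have "D \<le> exp 1 * E" by (rule DE)
    also have "\<dots> \<le> exp 1 * (\<Sum>j\<in>UNIV. xs $ j * (exp 1 * (\<Sum>k\<in>UNIV. Q $ k $ j * M k) * (?\<sigma> / (exp 1)\<^sup>2)))"
      using xs0 G' by (intro mult_left_mono order_trans[OF E[OF xs]] sum_mono) auto
    \<comment> \<open>The two factors e cancel the square of e from
      \<open>growth_bound\<close>.\<close>
    also have "\<dots> = ?\<sigma> * (\<Sum>j\<in>UNIV. \<Sum>k\<in>UNIV. M k * (Q $ k $ j * xs $ j))"
      by (simp add: sum_distrib_left power2_eq_square mult_ac)
    also have "\<dots> = ?\<sigma> * (\<Sum>k\<in>UNIV. M k * load xs k)"
      by (subst sum.swap) (simp add: matrix_vector_mult_def sum_distrib_left)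
    also have "\<dots> \<le> ?\<sigma> * (\<Sum>k\<in>UNIV. M k * (lam / \<Gamma>))"
      using \<sigma>_pos M0 lam by (intro mult_left_mono sum_mono) auto
    also have "\<dots> = ?\<sigma> * ((\<Sum>k\<in>UNIV. M k) * (lam / \<Gamma>))"
      by (simp only: sum_distrib_right)
    also have "\<dots> \<le> ?\<sigma> * ((1 + D) * (lam / \<Gamma>))"
      using \<sigma>_pos sumM lam0 by (intro mult_left_mono mult_right_mono) auto
    finally have "D * \<Gamma> \<le> lam * (?\<sigma> * (1 + D))"
      using \<Gamma>_pos by (simp add: field_simps)
    moreover have "0 < ?\<sigma> * (1 + D)" using \<sigma>_pos D1 by (rule mult_pos_pos)
    ultimately show ?thesis by (simp only: pos_divide_le_eq)
  qed
  then have "D * \<Gamma> / (?\<sigma> * (1 + D)) \<le> mpc_opt P C" by (rule le_mpc_optI)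
  then have "D * \<Gamma> \<le> (?\<sigma> * mpc_opt P C) * (1 + D)"
    using mult_pos_pos[OF \<sigma>_pos D1] by (simp only: pos_divide_le_eq mult_ac)
  also have "\<dots> \<le> (\<Gamma> / 2) * (1 + D)"
    using \<Gamma>_lower D1 by (intro mult_right_mono) auto
  finally have "\<Gamma> * (2 * D) \<le> \<Gamma> * (1 + D)" by (simp add: field_simps)
  then have "D \<le> 1" using \<Gamma>_pos by simp
  then show ?thesis using init_potential_le by (simp add: D_def)
qed

section \<open>The invariant along a run\<close>

definition good_config :: "real^'n \<Rightarrow> bool" where
  "good_config x \<longleftrightarrow> bounded_config x \<and> (\<exists>E G M. dual_certificate x E G M)"

lemma good_config_init: "good_config x\<^sub>0"
  using dual_certificate_init x\<^sub>0_le by (auto simp: good_config_def bounded_config_def)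

lemma good_config_potential_le: "good_config x \<Longrightarrow> \<Phi> x \<le> 2 * ln_em CARD('m)"
  using dual_certificate_potential_le by (auto simp: good_config_def)

lemma good_config_scaled_load: "good_config x \<Longrightarrow> scaled_load P \<Gamma> x < 3 * ln_em CARD('m)"
  using good_config_potential_le[of x] scaled_load_le_mpc_potential[of P \<Gamma> x] ln_em_ge_1 by linarith

text \<open>The potential bound at the current point supplies the load hypothesis for extending the
  certificate by one phase, which closes the induction. \<open>E\<close>, \<open>G\<close> and
  \<open>M\<close> are ghost quantities absent from the configuration, hence the existential in
  \<open>good_config\<close>.\<close>

lemma good_config_upd:
  assumes "good_config x" "c \<in> set C" "c \<bullet> x < 1"
  shows "good_config (upd c x)"
proof -
  have "load x k \<le> 3 * ln_em CARD('m)" for k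
    using good_config_potential_le[OF assms(1)] load_le_mpc_potential[of \<Gamma> P x k] ln_em_ge_1 by linarith
  moreover obtain E G M where "bounded_config x" "dual_certificate x E G M"
    using assms(1) by (auto simp: good_config_def)
  ultimately show ?thesis
    unfolding good_config_def using assms(2,3) bounded_config_upd dual_certificate_upd by blast
qed

fun good_state :: "'n mpc_config \<Rightarrow> bool" where
  "good_state (Run i x y) \<longleftrightarrow> i \<le> length C \<and> good_config x \<and> (\<forall>i'<i. 1 \<le> C ! i' \<bullet> x)"
| "good_state FAIL \<longleftrightarrow> False"

text \<open>Variables never decrease and coefficients are nonnegative, so constraints satisfied
  earlier stay satisfied.\<close>

lemma inner_upd_ge:
  assumes "bounded_config x" "c \<in> set C" "a \<in> set C"
  shows "a \<bullet> x \<le> a \<bullet> upd c x"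
  unfolding inner_vec_sum using le_upd[OF assms(1,2)] C_nonneg[OF assms(3)]
  by (intro sum_mono mult_left_mono) auto

lemma good_state_step:
  assumes "mpc_step P C \<Gamma> s t" "good_state s"
  shows "good_state t"
  using assms
proof cases
  case (satisfied i x y)
  then show ?thesis using assms(2) by (auto simp: less_Suc_eq)
next
  case (phase i x x' y' y)
  then have c: "C ! i \<in> set C" and x: "good_config x" using assms(2) by auto
  have "C ! i' \<bullet> x \<le> C ! i' \<bullet> x'" if "i' < i" for i'
    using inner_upd_ge[of x "C ! i" "C ! i'"] x c phase that by (auto simp: good_config_def)
  then show ?thesis
    using phase assms(2) good_config_upd[OF x c] by (force intro: order_trans)
next
  case (fail i x x' y)
  \<comment> \<open>The point after the phase would again be good, so its load lies below the
    threshold and this case is contradictory.\<close>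
  then have "good_config x'" using assms(2) good_config_upd[of x "C ! i"] by auto
  then show ?thesis using fail good_config_scaled_load[of x'] by (auto simp: ln_em_def)
qed

lemma good_state_reachable: "mpc_reachable P C \<Gamma> s \<Longrightarrow> good_state s"
  unfolding mpc_reachable_def
  by (induction rule: rtranclp_induct) (auto simp: good_config_init good_state_step)

text \<open>The constant 8 is the 2 of the potential bound times the 4 of the upper bound on
  \<open>\<Gamma>\<close>.\<close>

lemma packing_le:
  assumes "good_config x" and "\<Gamma> \<le> 4 * mpc_sigma P C * mpc_opt P C"
  shows "(MAX k. (P *v x) $ k) \<le> 8 * mpc_sigma P C * ln_em CARD('m) * mpc_opt P C"
proof -
  have "(P *v x) $ k \<le> 8 * mpc_sigma P C * ln_em CARD('m) * mpc_opt P C" for k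
  proof -
    have "(P *v x) $ k / \<Gamma> \<le> 2 * ln_em CARD('m)"
      using good_config_potential_le[OF assms(1)] load_le_mpc_potential[of \<Gamma> P x k]
      by (simp add: load_scaled)
    then have "(P *v x) $ k \<le> 2 * ln_em CARD('m) * \<Gamma>" using \<Gamma>_pos by (simp add: field_simps)
    also have "\<dots> \<le> 2 * ln_em CARD('m) * (4 * mpc_sigma P C * mpc_opt P C)"
      using assms(2) ln_em_ge_1 by (intro mult_left_mono) auto
    finally show ?thesis by (simp add: mult_ac)
  qed
  then show ?thesis by (intro Max.boundedI) auto
qed

section \<open>Termination, measured by the logarithmic room below the cap of
  \<open>bounded_config\<close>\<close>

definition log_slack :: "real^'n \<Rightarrow> real" where
  "log_slack x = (\<Sum>j\<in>UNIV. ln (mpc_mu CARD('m) / c_min) - ln (x $ j))"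

lemma log_slack_nonneg:
  assumes "bounded_config x" shows "0 \<le> log_slack x"
  unfolding log_slack_def
proof (intro sum_nonneg)
  fix j
  have "ln (x $ j) \<le> ln (mpc_mu CARD('m) / c_min)"
    using assms bounded_config_pos[OF assms, of j] by (intro ln_mono) (auto simp: bounded_config_def)
  then show "0 \<le> ln (mpc_mu CARD('m) / c_min) - ln (x $ j)" by simp
qed

text \<open>A variable attaining the minimum in \<open>eps\<close> grows by the factor
  \<open>\<mu>\<close>, and no variable shrinks.\<close>

lemma log_slack_upd:
  assumes x: "bounded_config x" and c: "c \<in> set C"
  shows "log_slack (upd c x) + ln (mpc_mu CARD('m)) \<le> log_slack x"
proof -
  have "log_slack x - log_slack (upd c x) = (\<Sum>j\<in>UNIV. ln (upd c x $ j) - ln (x $ j))"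
    by (simp add: log_slack_def flip: sum_subtractf)
  also have "\<dots> = (\<Sum>j\<in>UNIV. ln (1 + incr c x j))"
  proof (intro sum.cong refl)
    fix j
    show "ln (upd c x $ j) - ln (x $ j) = ln (1 + incr c x j)"
      using bounded_config_pos[OF x, of j] incr_nonneg[OF c, of x j] by (simp add: upd_component ln_mult)
  qed
  also obtain j where j: "incr c x j = mpc_mu CARD('m) - 1" using incr_eq_max[OF c] by blast
  have "ln (1 + incr c x j) \<le> (\<Sum>j\<in>UNIV. ln (1 + incr c x j))"
    using incr_nonneg[OF c] by (intro member_le_sum) auto
  finally show ?thesis using j by simp
qed

lemma reachable_step:
  "mpc_reachable P C \<Gamma> s \<Longrightarrow> mpc_step P C \<Gamma> s t \<Longrightarrow> mpc_reachable P C \<Gamma> t"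
  unfolding mpc_reachable_def by simp

lemma next_constraint_reachable:
  assumes "mpc_reachable P C \<Gamma> (Run i x y)" "i < length C"
  shows "\<exists>x y. mpc_reachable P C \<Gamma> (Run (Suc i) x y)"
  using assms(1)
\<comment> \<open>In units of \<open>ln \<mu>\<close> the slack drops by at least 1 per phase and
  stays nonnegative, so its floor strictly decreases.\<close>
proof (induction "nat \<lfloor>log_slack x / ln (mpc_mu CARD('m))\<rfloor>" arbitrary: x y rule: less_induct)
  case less
  show ?case
  proof (cases "1 \<le> C ! i \<bullet> x")
    case True
    then show ?thesis using reachable_step[OF less.prems mpc_step.satisfied] assms(2) by blast
  next
    case False
    let ?x' = "upd (C ! i) x"
    have c: "C ! i \<in> set C" using assms(2) by simp
    have x: "good_config x" using good_state_reachable[OF less.prems] by simp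
    have x': "good_config ?x'" using good_config_upd[OF x c] False by simp
    have reach: "\<exists>y'. mpc_reachable P C \<Gamma> (Run i ?x' y')"
      using reachable_step[OF less.prems mpc_step.phase[OF assms(2) _ refl refl]]
        good_config_scaled_load[OF x'] False by (auto simp: ln_em_def)
    have ln: "0 < ln (mpc_mu CARD('m))" using \<mu>_gt_1 by simp
    have "log_slack ?x' / ln (mpc_mu CARD('m)) + 1 \<le> log_slack x / ln (mpc_mu CARD('m))"
      using divide_right_mono[OF log_slack_upd[of x "C ! i"], of "ln (mpc_mu CARD('m))"] x c ln
      by (simp add: good_config_def add_divide_distrib)
    moreover have "0 \<le> log_slack ?x' / ln (mpc_mu CARD('m))"
      using log_slack_nonneg x' ln by (simp add: good_config_def)
    ultimately have "nat \<lfloor>log_slack ?x' / ln (mpc_mu CARD('m))\<rfloor> < nat \<lfloor>log_slack x / ln (mpc_mu CARD('m))\<rfloor>"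
      by linarith
    then show ?thesis using less.hyps reach by blast
  qed
qed

text \<open>Complements the invariant, which constrains reachable states but does not show that all
  rows get processed.\<close>

lemma complete_run_reachable: "\<exists>x y. mpc_reachable P C \<Gamma> (Run (length C) x y)"
proof -
  have "i \<le> length C \<Longrightarrow> \<exists>x y. mpc_reachable P C \<Gamma> (Run i x y)" for i
  proof (induction i)
    case 0
    show ?case unfolding mpc_reachable_def by blast
  next
    case (Suc i)
    then show ?case using next_constraint_reachable by (meson Suc_le_lessD Suc_leD)
  qed
  then show ?thesis by blast
qed

end

theorem theorem11:
  fixes P :: "real^'n^'m" and C :: "(real^'n) list" and \<Gamma> :: real
  assumes P_nonneg: "\<And>k j. 0 \<le> P $ k $ j"
    and C_nonneg: "\<And>c j. c \<in> set C \<Longrightarrow> 0 \<le> c $ j"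
    and C_nonempty: "C \<noteq> []"
    and feasible: "\<exists>x lam. mpc_feasible P C x lam"
    and rate_defined: "\<And>c j. c \<in> set C \<Longrightarrow> 0 < c $ j \<Longrightarrow> \<exists>k. 0 < P $ k $ j"
    and \<Gamma>_pos: "0 < \<Gamma>"
    and \<Gamma>_upper: "\<Gamma> \<le> 4 * mpc_sigma P C * mpc_opt P C"
    and \<Gamma>_lower: "2 * mpc_sigma P C * mpc_opt P C \<le> \<Gamma>"
  shows "\<not> mpc_reachable P C \<Gamma> FAIL
    \<and> (\<forall>i x y. mpc_reachable P C \<Gamma> (Run i x y) \<longrightarrow>
          (\<forall>i'<i. 1 \<le> C ! i' \<bullet> x)
        \<and> (MAX k. (P *v x) $ k)
            \<le> 8 * mpc_sigma P C * ln (exp 1 * real CARD('m)) * mpc_opt P C)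
    \<and> (\<exists>x y. mpc_reachable P C \<Gamma> (Run (length C) x y))"
proof -
  interpret mpc_instance P C \<Gamma>
    using assms by unfold_locales auto
  show ?thesis
  proof (intro conjI allI impI complete_run_reachable)
    show "\<not> mpc_reachable P C \<Gamma> FAIL"
      using good_state_reachable by fastforce
  next
    fix i x y i'
    assume "mpc_reachable P C \<Gamma> (Run i x y)" and "i' < i"
    then show "1 \<le> C ! i' \<bullet> x"
      using good_state_reachable by fastforce
  next
    fix i x y
    assume "mpc_reachable P C \<Gamma> (Run i x y)"
    then have "good_config x"
      using good_state_reachable by fastforce
    then show "(MAX k. (P *v x) $ k) \<le> 8 * mpc_sigma P C * ln (exp 1 * real CARD('m)) * mpc_opt P C"
      using packing_le[OF _ \<Gamma>_upper] by (simp add: ln_em_def)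
  qed
qed

end
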